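(* For all non-negative integers $n,k,\ell$, we have $L_1(n,k,\ell)=A(n,k,\ell)$, where $L_1(n,k,\ell)$ and $A(n,k,\ell)$ are as defined in the context.
   Context: A two-color partition of $n$ is a finite multiset of positive integers summing to $n$ (listed in non-increasing order), where each part carries one of two colors, red or green; a part of value $a$ and color red (resp. green) is written $a_r$ (resp. $a_g$). Two parts are numerically distinct if they have different numerical values. For an integer $d\ge 1$, let $\mathcal{L}_d(n)$ be the set of two-color partitions $\lambda_1>\lambda_2>\cdots>\lambda_m$ of $n$ into numerically distinct parts such that: (1) each red part $\lambda_i$ with $i<m$ satisfies $\lambda_i-\lambda_{i+1}\ge d$; (2) each green part $\lambda_i$ with $i<m$ satisfies $\lambda_i-\lambda_{i+1}\ge d+1$; (3) neither $1_g$ nor $(d-1)_g$ occurs as a part. Let $L_d(n,k,\ell)$ be the number of partitions in $\mathcal{L}_d(n)$ with exactly $k$ red parts and exactly $\ell$ green parts. Let $A(n,k,\ell)$ be the number of two-color partitions of $n$ consisting of $k+j$ pairwise distinct red parts (for some integer $j\ge 0$) and $\ell$ pairwise distinct even green parts, such that exactly $k$ of the red parts are larger than $\ell$. *)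

theory Defs
  imports "HOL-Library.Multiset"
begin

datatype color = Red | Green

type_synonym colored_part = "nat \<times> color"

definition two_color_partitions :: "nat \<Rightarrow> colored_part multiset set" where
  "two_color_partitions n =
     {M. (\<forall>p \<in># M. fst p > 0) \<and> sum_mset (image_mset fst M) = n}"

definition values_of :: "color \<Rightarrow> colored_part multiset \<Rightarrow> nat multiset" where
  "values_of c M = image_mset fst {#p \<in># M. snd p = c#}"

definition pairwise_distinct :: "'a multiset \<Rightarrow> bool" where
  "pairwise_distinct M \<longleftrightarrow> (\<forall>x. count M x \<le> 1)"

text \<open>
  The list \<open>ps\<close> is \<open>\<lambda>\<^sub>1 > \<lambda>\<^sub>2 > \<dots> > \<lambda>\<^sub>m\<close>, indexed from 0; as the values decrease strictly,
  the gaps are stated additively. The index condition \<open>Suc i < length ps\<close> exempts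
  the smallest part. The set is meant for \<open>d \<ge> 1\<close> only; for \<open>d = 1\<close> the exclusion of
  \<open>(d - 1)\<^sub>g = 0\<^sub>g\<close> is vacuous, since parts are positive.
\<close>

definition L_set :: "nat \<Rightarrow> nat \<Rightarrow> colored_part multiset set" where
  "L_set d n =
     {M \<in> two_color_partitions n.
        (\<exists>ps. mset ps = M \<and> sorted_wrt (\<lambda>p q. fst p > fst q) ps \<and>
           (\<forall>i. Suc i < length ps \<longrightarrow>
              (snd (ps ! i) = Red \<longrightarrow> fst (ps ! i) \<ge> fst (ps ! Suc i) + d) \<and>
              (snd (ps ! i) = Green \<longrightarrow> fst (ps ! i) \<ge> fst (ps ! Suc i) + (d + 1)))) \<and>
        (1, Green) \<notin># M \<and> (d - 1, Green) \<notin># M}"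

definition L_count :: "nat \<Rightarrow> nat \<Rightarrow> nat \<Rightarrow> nat \<Rightarrow> nat" where
  "L_count d n k l =
     card {M \<in> L_set d n. size (values_of Red M) = k \<and> size (values_of Green M) = l}"

text \<open>Red and green parts may share numerical values here.\<close>

definition A_set :: "nat \<Rightarrow> nat \<Rightarrow> nat \<Rightarrow> colored_part multiset set" where
  "A_set n k l =
     {M \<in> two_color_partitions n.
        (\<exists>j. size (values_of Red M) = k + j) \<and> pairwise_distinct (values_of Red M) \<and>
        size (values_of Green M) = l \<and> pairwise_distinct (values_of Green M) \<and>
        (\<forall>a \<in># values_of Green M. even a) \<and>
        size {#a \<in># values_of Red M. a > l#} = k}"

definition A_count :: "nat \<Rightarrow> nat \<Rightarrow> nat \<Rightarrow> nat" where
  "A_count n k l = card (A_set n k l)"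

text \<open>Finiteness ensures that the cardinalities above are genuine counts.\<close>

lemma finite_two_color_partitions: "finite (two_color_partitions n)"
proof (rule finite_subset)
  let ?S = "{1..n} \<times> {Red, Green}"
  show "two_color_partitions n \<subseteq> mset ` {ps. set ps \<subseteq> ?S \<and> length ps \<le> n}"
  proof
    fix M assume "M \<in> two_color_partitions n"
    then have pos: "\<forall>p \<in># M. fst p > 0" and sum: "sum_mset (image_mset fst M) = n"
      by (auto simp: two_color_partitions_def)
    obtain ps where ps: "mset ps = M" using ex_mset by blast
    have pos': "\<forall>p \<in> set ps. fst p > 0" and sum': "sum_list (map fst ps) = n"
      using pos sum unfolding ps[symmetric] by (simp_all flip: sum_mset_sum_list)
    have "length ps \<le> sum_list (map fst ps)"
      using pos' by (induction ps) auto
    moreover have "fst p \<le> sum_list (map fst ps)" if "p \<in> set ps" for p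
      using that by (intro member_le_sum_list) auto
    moreover have "snd p \<in> {Red, Green}" for p :: colored_part
      by (cases "snd p") auto
    ultimately have "set ps \<subseteq> ?S \<and> length ps \<le> n"
      using pos' sum' by (fastforce simp: Suc_le_eq)
    then show "M \<in> mset ` {ps. set ps \<subseteq> ?S \<and> length ps \<le> n}"
      using ps by blast
  qed
  show "finite (mset ` {ps. set ps \<subseteq> ?S \<and> length ps \<le> n})"
    by (intro finite_imageI finite_lists_length_le) auto
qed

end

theory Submission
  imports Defs "HOL-Computational_Algebra.Formal_Power_Series"
begin

text \<open>
  Reading a partition in \<open>L\<^sub>1\<close> from its smallest part, either all parts exceed 1, or the smallest
  part is \<open>1\<^sub>r\<close>, or it is \<open>2\<^sub>g\<close>. Removing that part and shifting the others down gives, with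
  \<open>m = k + l\<close>, the recurrence
  \<open>(1 - q\<^sup>m) L(k, l) = q\<^sup>m L(k - 1, l) + q\<^bsup>2m\<^esup> L(k, l - 1)\<close> for the generating functions.
  On the other side, the generating function is a product over the red parts above \<open>l\<close>, the red
  parts up to \<open>l\<close> and the green parts. The factors \<open>1 + q\<^sup>i\<close> for the red parts \<open>i \<le> l\<close> turn the
  denominators \<open>1 - q\<^bsup>2i\<^esup>\<close> of the even green parts into \<open>1 - q\<^sup>i\<close>, so that
  \<open>(1 - q\<^sup>k) A(k, l) = q\<^bsup>k+l\<^esup> A(k - 1, l)\<close> and \<open>(1 - q\<^sup>l) A(k, l) = q\<^bsup>2l+k\<^esup> A(k, l - 1)\<close>.
  Since \<open>1 - q\<^sup>m = (1 - q\<^sup>k) + q\<^sup>k (1 - q\<^sup>l)\<close>, the product satisfies the same recurrence.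
\<close>

section \<open>Generating functions of graded sets\<close>

text \<open>Finiteness of each level matters because \<open>card\<close> is 0 on infinite sets,
  which would break additivity over disjoint unions.\<close>

definition graded :: "'a set \<Rightarrow> ('a \<Rightarrow> nat) \<Rightarrow> bool" where
  "graded S w \<longleftrightarrow> (\<forall>n. finite {x \<in> S. w x = n})"

text \<open>Integer coefficients make factors such as \<open>1 - fps_X ^ m\<close> available and
  allow nonzero factors to be cancelled.\<close>

definition gen_fun :: "'a set \<Rightarrow> ('a \<Rightarrow> nat) \<Rightarrow> int fps" where
  "gen_fun S w = Abs_fps (\<lambda>n. int (card {x \<in> S. w x = n}))"

lemma graded_subset:
  assumes "graded T w" "S \<subseteq> T" shows "graded S w"
  unfolding graded_def
proof
  fix n
  have "{x \<in> S. w x = n} \<subseteq> {x \<in> T. w x = n}" using assms(2) by blast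
  then show "finite {x \<in> S. w x = n}"
    by (rule finite_subset) (use assms(1) in \<open>simp add: graded_def\<close>)
qed

lemma gen_fun_empty [simp]: "gen_fun {} w = 0"
  by (simp add: gen_fun_def fps_eq_iff)

lemma gen_fun_single: "gen_fun {x} w = fps_X ^ w x"
proof -
  have "{y \<in> {x}. w y = n} = (if n = w x then {x} else {})" for n
    by auto
  then show ?thesis
    by (auto simp: gen_fun_def fps_eq_iff fps_X_power_iff)
qed

text \<open>The bijection carries level \<open>n - c\<close> of \<open>S\<close> onto level
  \<open>n\<close> of \<open>T\<close>; below degree \<open>c\<close> the set \<open>T\<close> has
  no elements. Adding a part and shifting all parts are both of this form.\<close>

lemma gen_fun_bij:
  assumes "bij_betw f S T" and "\<And>x. x \<in> S \<Longrightarrow> v (f x) = w x + c"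
  shows "gen_fun T v = fps_X ^ c * gen_fun S w"
proof -
  have "card {y \<in> T. v y = n} = (if n < c then 0 else card {x \<in> S. w x = n - c})" for n
  proof (cases "n < c")
    case True
    have none: "{y \<in> T. v y = n} = {}"
      using assms True by (auto simp: bij_betw_def)
    show ?thesis unfolding none using True by simp
  next
    case False
    have "bij_betw f {x \<in> S. w x = n - c} {y \<in> T. v y = n}"
      using assms False unfolding bij_betw_def by (auto simp: inj_on_def image_iff)
    then show ?thesis using False by (simp add: bij_betw_same_card)
  qed
  then show ?thesis
    by (simp add: gen_fun_def fps_eq_iff fps_X_power_mult_nth)
qed

lemma gen_fun_Un:
  assumes "graded S w" "graded T w" "S \<inter> T = {}"
  shows "gen_fun (S \<union> T) w = gen_fun S w + gen_fun T w"
proof -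
  have "card {x \<in> S \<union> T. w x = n} = card {x \<in> S. w x = n} + card {x \<in> T. w x = n}" for n
  proof -
    have "{x \<in> S \<union> T. w x = n} = {x \<in> S. w x = n} \<union> {x \<in> T. w x = n}" by auto
    then show ?thesis
      using assms by (auto simp: graded_def intro!: card_Un_disjoint)
  qed
  then show ?thesis by (simp add: gen_fun_def fps_eq_iff)
qed

text \<open>Cauchy product: pairs of weight \<open>n\<close> are classified by the weight
  \<open>i\<close> of the first component, and each class is a product of two finite levels.\<close>

lemma
  assumes "graded S w" "graded T v"
  shows graded_times: "graded (S \<times> T) (\<lambda>(x, y). w x + v y)"
    and gen_fun_times: "gen_fun (S \<times> T) (\<lambda>(x, y). w x + v y) = gen_fun S w * gen_fun T v"
proof -
  let ?F = "\<lambda>n i. {x \<in> S. w x = i} \<times> {y \<in> T. v y = n - i}"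
  have eq: "{p \<in> S \<times> T. (case p of (x, y) \<Rightarrow> w x + v y) = n} = (\<Union>i\<in>{0..n}. ?F n i)" for n
    by auto
  have fin: "finite (?F n i)" for n i
    using assms by (auto simp: graded_def)
  show "graded (S \<times> T) (\<lambda>(x, y). w x + v y)"
    unfolding graded_def eq using fin by blast
  have "card (\<Union>i\<in>{0..n}. ?F n i) = (\<Sum>i=0..n. card (?F n i))" for n
    by (rule card_UN_disjoint) (use fin in auto)
  then show "gen_fun (S \<times> T) (\<lambda>(x, y). w x + v y) = gen_fun S w * gen_fun T v"
    unfolding gen_fun_def fps_eq_iff eq by (simp add: fps_mult_nth card_cartesian_product)
qed

lemma finite_bounded_sum: "finite {B :: nat set. finite B \<and> \<Sum>B \<le> n}"
proof (rule finite_subset)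
  show "{B. finite B \<and> \<Sum>B \<le> n} \<subseteq> Pow {..n}"
  proof (intro subsetI PowI)
    fix B :: "nat set" and x assume "B \<in> {B. finite B \<and> \<Sum>B \<le> n}" "x \<in> B"
    then show "x \<in> {..n}"
      using member_le_sum[of x B "\<lambda>x. x"] by simp
  qed
qed simp

section \<open>Sets of parts above a bound\<close>

definition parts_above :: "nat \<Rightarrow> nat \<Rightarrow> nat set set" where
  "parts_above k s = {B. finite B \<and> card B = k \<and> (\<forall>x\<in>B. s < x)}"

text \<open>The factor \<open>c\<close> is 1 for red parts and 2 for even green parts, which are
  recorded by their halves.\<close>

abbreviation parts_gf :: "nat \<Rightarrow> nat \<Rightarrow> nat \<Rightarrow> int fps" where
  "parts_gf c k s \<equiv> gen_fun (parts_above k s) (\<lambda>B. c * \<Sum>B)"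

lemma graded_finite_sets:
  assumes "c > 0" shows "graded {B :: nat set. finite B} (\<lambda>B. c * \<Sum>B)"
  unfolding graded_def
proof
  fix n
  have "\<Sum>B \<le> c * \<Sum>B" for B :: "nat set" using assms by simp
  then show "finite {x \<in> {B::nat set. finite B}. c * \<Sum>x = n}"
    by (intro finite_subset[OF _ finite_bounded_sum[of n]]) auto
qed

lemma graded_parts_above: "c > 0 \<Longrightarrow> graded (parts_above k s) (\<lambda>B. c * \<Sum>B)"
  by (rule graded_subset[OF graded_finite_sets]) (auto simp: parts_above_def)

lemma sum_image_Suc: "finite B \<Longrightarrow> \<Sum>(Suc ` B) = \<Sum>B + card B"
  by (simp add: sum.reindex sum_Suc)

lemma image_Suc_vimage: "0 \<notin> B \<Longrightarrow> Suc ` (Suc -` B) = B"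
  by (auto simp: image_iff) (metis not0_implies_Suc)

lemma finite_card_vimage_Suc:
  assumes "finite B" "0 \<notin> B"
  shows "finite (Suc -` B)" "card (Suc -` B) = card B"
proof -
  show "finite (Suc -` B)" using assms by (simp add: finite_vimageI)
  show "card (Suc -` B) = card B"
    by (metis assms(2) card_image image_Suc_vimage inj_Suc inj_on_subset subset_UNIV)
qed

lemma parts_gf_0: "parts_gf c 0 s = 1"
proof -
  have "parts_above 0 s = {{}}" by (auto simp: parts_above_def)
  then show ?thesis by (simp add: gen_fun_single)
qed

text \<open>Raising each of the \<open>k\<close> parts by 1 adds \<open>c * k\<close> to the
  weight.\<close>

lemma parts_gf_shift: "parts_gf c k (Suc s) = fps_X ^ (c * k) * parts_gf c k s"
proof (rule gen_fun_bij)
  show "bij_betw (image Suc) (parts_above k s) (parts_above k (Suc s))"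
  proof (rule bij_betwI[where g = "vimage Suc"])
    show "vimage Suc \<in> parts_above k (Suc s) \<rightarrow> parts_above k s"
    proof
      fix B assume B: "B \<in> parts_above k (Suc s)"
      then have "0 \<notin> B" "finite B" by (auto simp: parts_above_def)
      from finite_card_vimage_Suc[OF this(2,1)] B show "Suc -` B \<in> parts_above k s"
        by (auto simp: parts_above_def)
    qed
    show "Suc ` (Suc -` B) = B" if "B \<in> parts_above k (Suc s)" for B
      using that by (intro image_Suc_vimage) (auto simp: parts_above_def)
  qed (auto simp: parts_above_def card_image)
  show "c * \<Sum>(Suc ` B) = c * \<Sum>B + c * k" if "B \<in> parts_above k s" for B
    using that by (auto simp: parts_above_def sum_image_Suc algebra_simps)
qed

text \<open>The least admissible value \<open>Suc s\<close> is either absent or present; in the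
  second case its removal leaves \<open>k\<close> parts above \<open>Suc s\<close>.\<close>

lemma parts_gf_split:
  assumes "c > 0"
  shows "parts_gf c (Suc k) s = parts_gf c (Suc k) (Suc s)
    + fps_X ^ (c * Suc s) * parts_gf c k (Suc s)"
proof -
  let ?T = "{B \<in> parts_above (Suc k) s. Suc s \<in> B}"
  have split: "parts_above (Suc k) s = parts_above (Suc k) (Suc s) \<union> ?T"
    by (auto simp: parts_above_def) (metis Suc_lessI)
  have "bij_betw (insert (Suc s)) (parts_above k (Suc s)) ?T"
  proof (rule bij_betwI[where g = "\<lambda>B. B - {Suc s}"])
    show "(\<lambda>B. B - {Suc s}) \<in> ?T \<rightarrow> parts_above k (Suc s)"
      by (auto simp: parts_above_def)
    show "insert (Suc s) \<in> parts_above k (Suc s) \<rightarrow> ?T"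
      by (force simp: parts_above_def card_insert_if)
  qed (auto simp: parts_above_def)
  then have "gen_fun ?T (\<lambda>B. c * \<Sum>B) = fps_X ^ (c * Suc s) * parts_gf c k (Suc s)"
  proof (rule gen_fun_bij)
    show "c * \<Sum>(insert (Suc s) B) = c * \<Sum>B + c * Suc s" if "B \<in> parts_above k (Suc s)" for B
    proof -
      have "Suc s \<notin> B" "finite B" using that by (auto simp: parts_above_def)
      then show ?thesis by (simp add: algebra_simps)
    qed
  qed
  moreover have "gen_fun (parts_above (Suc k) (Suc s) \<union> ?T) (\<lambda>B. c * \<Sum>B)
      = parts_gf c (Suc k) (Suc s) + gen_fun ?T (\<lambda>B. c * \<Sum>B)"
  proof (rule gen_fun_Un)
    show "graded ?T (\<lambda>B. c * \<Sum>B)"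
      by (rule graded_subset[OF graded_parts_above[OF assms]]) auto
    show "graded (parts_above (Suc k) (Suc s)) (\<lambda>B. c * \<Sum>B)"
      by (rule graded_parts_above[OF assms])
  qed (auto simp: parts_above_def)
  ultimately show ?thesis using split by metis
qed

text \<open>Shifting brings both terms of the split back to the bound \<open>s\<close>, with
  exponents \<open>c * Suc k\<close> and \<open>c * Suc s + c * k\<close>; the first term then moves
  to the left.\<close>

lemma parts_gf_rec:
  assumes "c > 0"
  shows "(1 - fps_X ^ (c * Suc k)) * parts_gf c (Suc k) s
    = fps_X ^ (c * (Suc k + s)) * parts_gf c k s"
  using parts_gf_split[OF assms, of k s] unfolding parts_gf_shift
  by (simp add: algebra_simps power_add)

text \<open>Subsets are separated by whether they contain \<open>Suc l\<close>. This supplies the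
  factors for the red parts up to \<open>l\<close>.\<close>

lemma subsets_gf_Suc:
  "gen_fun (Pow {1..Suc l}) (\<lambda>B. \<Sum>B) = (1 + fps_X ^ Suc l) * gen_fun (Pow {1..l}) (\<lambda>B. \<Sum>B)"
proof -
  let ?T = "insert (Suc l) ` Pow {1..l}"
  have fin: "graded S (\<lambda>B. \<Sum>B)" if "finite S" for S :: "nat set set"
    using that by (auto simp: graded_def)
  have "inj_on (insert (Suc l)) (Pow {1..l})"
    by (rule inj_onI) (metis Diff_insert_absorb PowD Suc_n_not_le_n atLeastAtMost_iff subsetD)
  then have "gen_fun ?T (\<lambda>B. \<Sum>B) = fps_X ^ Suc l * gen_fun (Pow {1..l}) (\<lambda>B. \<Sum>B)"
  proof (intro gen_fun_bij)
    show "\<Sum>(insert (Suc l) B) = \<Sum>B + Suc l" if "B \<in> Pow {1..l}" for B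
    proof -
      have "Suc l \<notin> B" "finite B" using that by (auto intro: finite_subset)
      then show ?thesis by simp
    qed
  qed (simp add: bij_betw_def)
  moreover have "Pow {1..Suc l} = Pow {1..l} \<union> ?T"
    by (simp add: atLeastAtMostSuc_conv Pow_insert)
  moreover have "Pow {1..l} \<inter> ?T = {}" by auto
  ultimately show ?thesis by (simp add: gen_fun_Un fin algebra_simps)
qed

section \<open>The two families as pairs of sets\<close>

text \<open>A two-color partition without repeated colored parts is the pair of its set of red values
  and its set of green values.\<close>

abbreviation weight :: "nat set \<times> nat set \<Rightarrow> nat" where
  "weight \<equiv> \<lambda>(R, G). \<Sum>R + \<Sum>G"

text \<open>The number \<open>s\<close> is a floor below all parts. Different values already give
  the red gap of 1, so only green parts need a condition: \<open>Suc a\<close> must not sit directly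
  above \<open>a\<close>. Inserting \<open>s\<close> lets the floor act as one more part; for
  \<open>s = 0\<close> it excludes the green 1.\<close>

definition L_pairs :: "nat \<Rightarrow> nat \<Rightarrow> nat \<Rightarrow> (nat set \<times> nat set) set" where
  "L_pairs k l s = {(R, G). finite R \<and> finite G \<and> card R = k \<and> card G = l \<and> R \<inter> G = {} \<and>
     (\<forall>x\<in>R \<union> G. s < x) \<and> (\<forall>a. Suc a \<in> G \<longrightarrow> a \<notin> insert s (R \<union> G))}"

text \<open>Red values up to \<open>l\<close> are left free, which accounts for the arbitrary number
  \<open>j\<close> of small red parts.\<close>

definition A_pairs :: "nat \<Rightarrow> nat \<Rightarrow> (nat set \<times> nat set) set" where
  "A_pairs k l = {(R, G). finite R \<and> finite G \<and> 0 \<notin> R \<union> G \<and> card {a \<in> R. l < a} = k \<and>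
     card G = l \<and> (\<forall>a\<in>G. even a)}"

lemma graded_pairs: "graded {(R, G). finite R \<and> finite G} weight"
proof -
  have "graded ({B :: nat set. finite B} \<times> {B :: nat set. finite B}) weight"
    using graded_times[OF graded_finite_sets[of 1] graded_finite_sets[of 1]] by simp
  then show ?thesis by (rule graded_subset) auto
qed

lemma graded_L_pairs: "graded (L_pairs k l s) weight"
  by (rule graded_subset[OF graded_pairs]) (auto simp: L_pairs_def)

section \<open>Recurrence for the partitions with gap conditions\<close>

text \<open>All conditions are invariant under translation of the parts together with the floor, and
  there are \<open>k + l\<close> parts to raise.\<close>

lemma L_gf_shift:
  "gen_fun (L_pairs k l (Suc s)) weight = fps_X ^ (k + l) * gen_fun (L_pairs k l s) weight"
proof (rule gen_fun_bij)
  show "bij_betw (map_prod (image Suc) (image Suc)) (L_pairs k l s) (L_pairs k l (Suc s))"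
  proof (rule bij_betwI[where g = "map_prod (vimage Suc) (vimage Suc)"])
    show "map_prod (vimage Suc) (vimage Suc) \<in> L_pairs k l (Suc s) \<rightarrow> L_pairs k l s"
    proof
      fix p assume p: "p \<in> L_pairs k l (Suc s)"
      obtain R G where [simp]: "p = (R, G)" by force
      from p have "0 \<notin> R" "finite R" "0 \<notin> G" "finite G" by (auto simp: L_pairs_def)
      with p finite_card_vimage_Suc[of R] finite_card_vimage_Suc[of G]
      show "map_prod (vimage Suc) (vimage Suc) p \<in> L_pairs k l s"
        by (auto simp: L_pairs_def)
    qed
    show "map_prod (image Suc) (image Suc) (map_prod (vimage Suc) (vimage Suc) p) = p"
      if p: "p \<in> L_pairs k l (Suc s)" for p
    proof -
      obtain R G where [simp]: "p = (R, G)" by force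
      from p have "0 \<notin> R" "0 \<notin> G" by (auto simp: L_pairs_def)
      then show ?thesis by (simp add: image_Suc_vimage del: image_vimage_eq)
    qed
    show "map_prod (image Suc) (image Suc) \<in> L_pairs k l s \<rightarrow> L_pairs k l (Suc s)"
      by (auto simp: L_pairs_def card_image)
    show "map_prod (vimage Suc) (vimage Suc) (map_prod (image Suc) (image Suc) p) = p" for p
      by (cases p) (simp add: inj_vimage_image_eq)
  qed
  show "weight (map_prod (image Suc) (image Suc) p) = weight p + (k + l)"
    if "p \<in> L_pairs k l s" for p
    using that by (auto simp: L_pairs_def sum_image_Suc)
qed

text \<open>The removed red part \<open>Suc s\<close> becomes the new floor: its gap to a green part
  above it is exactly the floor condition for \<open>Suc s\<close>. The case \<open>k = 0\<close> is
  separate because \<open>k - 1\<close> is truncated.\<close>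

lemma L_gf_smallest_red:
  "gen_fun {(R, G) \<in> L_pairs k l s. Suc s \<in> R} weight =
    (if k = 0 then 0 else fps_X ^ Suc s * gen_fun (L_pairs (k - 1) l (Suc s)) weight)"
proof (cases k)
  case 0
  then have "{(R, G) \<in> L_pairs k l s. Suc s \<in> R} = {}" by (auto simp: L_pairs_def)
  then show ?thesis using 0 by (simp only: gen_fun_empty) simp
next
  case (Suc k')
  let ?f = "\<lambda>(R, G). (insert (Suc s) R, G :: nat set)"
  let ?T = "{(R, G) \<in> L_pairs k l s. Suc s \<in> R}"
  have "gen_fun ?T weight
      = fps_X ^ Suc s * gen_fun (L_pairs k' l (Suc s)) weight"
  proof (rule gen_fun_bij)
    show "bij_betw ?f (L_pairs k' l (Suc s)) ?T"
    proof (rule bij_betwI[where g = "\<lambda>(R, G). (R - {Suc s}, G)"])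
      show "?f \<in> L_pairs k' l (Suc s) \<rightarrow> ?T"
      proof
        fix p assume p: "p \<in> L_pairs k' l (Suc s)"
        obtain R G where [simp]: "p = (R, G)" by force
        have notin: "Suc s \<notin> R" "Suc s \<notin> G" and above: "\<And>x. x \<in> R \<union> G \<Longrightarrow> s < x"
          using p by (auto simp: L_pairs_def dest: Suc_lessD)
        from p have "R \<inter> G = {}" "finite R" "finite G" "card R = k'" "card G = l"
          and "\<And>a. Suc a \<in> G \<Longrightarrow> a \<noteq> Suc s \<and> a \<notin> R \<union> G"
          by (auto simp: L_pairs_def)
        with notin above Suc show "?f p \<in> ?T"
          unfolding L_pairs_def by auto
      qed
      show "(\<lambda>(R, G). (R - {Suc s}, G)) \<in> ?T \<rightarrow> L_pairs k' l (Suc s)"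
      proof
        fix p assume p: "p \<in> ?T"
        obtain R G where [simp]: "p = (R, G)" by force
        have "Suc s \<in> R" "Suc s \<notin> G" and gt: "\<And>x. x \<in> R \<union> G \<Longrightarrow> s < x"
          using p by (auto simp: L_pairs_def)
        then have above: "Suc s < x" if "x \<in> R - {Suc s} \<union> G" for x
          using that gt[of x] by (intro Suc_lessI) auto
        from p have "R \<inter> G = {}" "finite R" "finite G" "card R = k" "card G = l"
          and "\<And>a. Suc a \<in> G \<Longrightarrow> a \<notin> R \<union> G"
          by (auto simp: L_pairs_def)
        with \<open>Suc s \<in> R\<close> above Suc show "(\<lambda>(R, G). (R - {Suc s}, G)) p \<in> L_pairs k' l (Suc s)"
          unfolding L_pairs_def by auto
      qed
      show "(\<lambda>(R, G). (R - {Suc s}, G)) (?f p) = p" if "p \<in> L_pairs k' l (Suc s)" for p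
        using that by (force simp: L_pairs_def)
    qed auto
    show "weight (?f p) = weight p + Suc s" if p: "p \<in> L_pairs k' l (Suc s)" for p
    proof -
      obtain R G where [simp]: "p = (R, G)" by force
      have "Suc s \<notin> R" "finite R" using p by (auto simp: L_pairs_def)
      then show ?thesis by simp
    qed
  qed
  then show ?thesis using Suc by simp
qed

text \<open>A green \<open>Suc (Suc s)\<close> is two above the old floor, as its gap requires, and
  after its removal it serves as the new floor for the remaining parts.\<close>

lemma L_gf_smallest_green:
  "gen_fun {(R, G) \<in> L_pairs k l s. Suc s \<notin> R \<and> Suc (Suc s) \<in> G} weight =
    (if l = 0 then 0 else fps_X ^ Suc (Suc s) * gen_fun (L_pairs k (l - 1) (Suc (Suc s))) weight)"
proof (cases l)
  case 0
  then have "{(R, G) \<in> L_pairs k l s. Suc s \<notin> R \<and> Suc (Suc s) \<in> G} = {}"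
    by (auto simp: L_pairs_def)
  then show ?thesis using 0 by (simp only: gen_fun_empty) simp
next
  case (Suc l')
  let ?f = "\<lambda>(R :: nat set, G). (R, insert (Suc (Suc s)) G)"
  let ?T = "{(R, G) \<in> L_pairs k l s. Suc s \<notin> R \<and> Suc (Suc s) \<in> G}"
  have "gen_fun ?T weight
      = fps_X ^ Suc (Suc s) * gen_fun (L_pairs k l' (Suc (Suc s))) weight"
  proof (rule gen_fun_bij)
    show "bij_betw ?f (L_pairs k l' (Suc (Suc s))) ?T"
    proof (rule bij_betwI[where g = "\<lambda>(R, G). (R, G - {Suc (Suc s)})"])
      show "?f \<in> L_pairs k l' (Suc (Suc s)) \<rightarrow> ?T"
      proof
        fix p assume p: "p \<in> L_pairs k l' (Suc (Suc s))"
        obtain R G where [simp]: "p = (R, G)" by force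
        have gt: "\<And>x. x \<in> R \<union> G \<Longrightarrow> Suc (Suc s) < x"
          using p by (auto simp: L_pairs_def)
        have notin: "Suc (Suc s) \<notin> R" "Suc (Suc s) \<notin> G" "Suc s \<notin> R" "Suc s \<notin> G"
          and above: "\<And>x. x \<in> R \<union> G \<Longrightarrow> s < x"
          using gt by (auto dest: Suc_lessD)
        from p have "R \<inter> G = {}" "finite R" "finite G" "card R = k" "card G = l'"
          and "\<And>a. Suc a \<in> G \<Longrightarrow> a \<noteq> Suc (Suc s) \<and> a \<notin> R \<union> G"
          by (auto simp: L_pairs_def)
        with notin above Suc show "?f p \<in> ?T"
          unfolding L_pairs_def by auto
      qed
      show "(\<lambda>(R, G). (R, G - {Suc (Suc s)})) \<in> ?T \<rightarrow> L_pairs k l' (Suc (Suc s))"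
      proof
        fix p assume p: "p \<in> ?T"
        obtain R G where [simp]: "p = (R, G)" by force
        have notin: "Suc s \<notin> R" "Suc s \<notin> G" "Suc (Suc s) \<in> G" "Suc (Suc s) \<notin> R"
          and gt: "\<And>x. x \<in> R \<union> G \<Longrightarrow> s < x"
          using p by (auto simp: L_pairs_def)
        have above: "Suc (Suc s) < x" if "x \<in> R \<union> (G - {Suc (Suc s)})" for x
          using that gt[of x] notin by (intro Suc_lessI) auto
        from p have "R \<inter> G = {}" "finite R" "finite G" "card R = k" "card G = l"
          and "\<And>a. Suc a \<in> G \<Longrightarrow> a \<notin> R \<union> G"
          by (auto simp: L_pairs_def)
        with notin(3) above Suc
        show "(\<lambda>(R, G). (R, G - {Suc (Suc s)})) p \<in> L_pairs k l' (Suc (Suc s))"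
          unfolding L_pairs_def by auto
      qed
      show "(\<lambda>(R, G). (R, G - {Suc (Suc s)})) (?f p) = p"
        if "p \<in> L_pairs k l' (Suc (Suc s))" for p
        using that by (force simp: L_pairs_def)
    qed auto
    show "weight (?f p) = weight p + Suc (Suc s)" if p: "p \<in> L_pairs k l' (Suc (Suc s))" for p
    proof -
      obtain R G where [simp]: "p = (R, G)" by force
      have "Suc (Suc s) \<notin> G" "finite G" using p by (auto simp: L_pairs_def)
      then show ?thesis by simp
    qed
  qed
  then show ?thesis using Suc by simp
qed

text \<open>Three cases: the floor can be raised to \<open>Suc s\<close>, or \<open>Suc s\<close> is
  a red part, or the smallest part is a green \<open>Suc (Suc s)\<close>.\<close>

lemma L_gf_split:
  "gen_fun (L_pairs k l s) weight = gen_fun (L_pairs k l (Suc s)) weight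
    + (if k = 0 then 0 else fps_X ^ Suc s * gen_fun (L_pairs (k - 1) l (Suc s)) weight)
    + (if l = 0 then 0 else fps_X ^ Suc (Suc s) * gen_fun (L_pairs k (l - 1) (Suc (Suc s))) weight)"
proof -
  let ?T = "{(R, G) \<in> L_pairs k l s. Suc s \<in> R}"
  let ?U = "{(R, G) \<in> L_pairs k l s. Suc s \<notin> R \<and> Suc (Suc s) \<in> G}"
  have "p \<in> L_pairs k l (Suc s) \<union> ?T \<union> ?U" if p: "p \<in> L_pairs k l s" for p
  proof (rule ccontr)
    assume np: "p \<notin> L_pairs k l (Suc s) \<union> ?T \<union> ?U"
    obtain R G where [simp]: "p = (R, G)" by force
    \<comment> \<open>A green \<open>Suc s\<close> is excluded by the floor condition at
      \<open>a = s\<close>; the other two are the cases assumed to fail.\<close>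
    have notin: "Suc s \<notin> R" "Suc s \<notin> G" "Suc (Suc s) \<notin> G"
      and gt: "\<And>x. x \<in> R \<union> G \<Longrightarrow> s < x"
      using p np by (auto simp: L_pairs_def)
    have "Suc s < x" if "x \<in> R \<union> G" for x
      using that gt[of x] notin by (intro Suc_lessI) auto
    then have "p \<in> L_pairs k l (Suc s)"
      using p notin(3) unfolding L_pairs_def by auto
    with np show False by blast
  qed
  moreover have "L_pairs k l (Suc s) \<subseteq> L_pairs k l s"
  proof
    fix p assume p: "p \<in> L_pairs k l (Suc s)"
    obtain R G where [simp]: "p = (R, G)" by force
    have "Suc s \<notin> G" "\<And>x. x \<in> R \<union> G \<Longrightarrow> s < x"
      using p by (auto simp: L_pairs_def dest: Suc_lessD)
    with p show "p \<in> L_pairs k l s" unfolding L_pairs_def by auto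
  qed
  ultimately have split: "L_pairs k l s = L_pairs k l (Suc s) \<union> ?T \<union> ?U"
    by blast
  have disj: "L_pairs k l (Suc s) \<inter> ?T = {}" "(L_pairs k l (Suc s) \<union> ?T) \<inter> ?U = {}"
    by (auto simp: L_pairs_def)
  have grT: "graded ?T weight" and grU: "graded ?U weight"
    and grLT: "graded (L_pairs k l (Suc s) \<union> ?T) weight"
    by (rule graded_subset[OF graded_L_pairs[of k l s]]; use split in blast)+
  have "gen_fun (L_pairs k l (Suc s) \<union> ?T \<union> ?U) weight
      = gen_fun (L_pairs k l (Suc s)) weight + gen_fun ?T weight + gen_fun ?U weight"
    by (simp only: gen_fun_Un[OF grLT grU disj(2)] gen_fun_Un[OF graded_L_pairs grT disj(1)])
  then show ?thesis
    unfolding L_gf_smallest_red L_gf_smallest_green split[symmetric] .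
qed

text \<open>Shifting all terms of the split back to floor 0 gives the exponents
  \<open>k + l\<close>, \<open>1 + (k - 1 + l)\<close> and
  \<open>2 + 2 * (k + l - 1)\<close>.\<close>

lemma L_gf_rec:
  "(1 - fps_X ^ (k + l)) * gen_fun (L_pairs k l 0) weight =
    (if k = 0 then 0 else fps_X ^ (k + l) * gen_fun (L_pairs (k - 1) l 0) weight)
    + (if l = 0 then 0 else fps_X ^ (2 * (k + l)) * gen_fun (L_pairs k (l - 1) 0) weight)"
  using L_gf_split[of k l 0] unfolding L_gf_shift
  by (cases k; cases l) (simp_all add: algebra_simps power_add mult_2_right)

section \<open>Product formula and recurrences for the partitions with even green parts\<close>

text \<open>The red set is cut at \<open>l\<close>, and the green set is halved; the three resulting
  sets vary independently.\<close>

lemma A_gf_prod: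
  "gen_fun (A_pairs k l) weight
    = gen_fun (Pow {1..l}) (\<lambda>B. \<Sum>B) * parts_gf 1 k l * parts_gf 2 l 0"
proof -
  let ?S = "(Pow {1..l} \<times> parts_above k l) \<times> parts_above l 0"
  \<comment> \<open>The factor \<open>1 *\<close> gives the weight the shape used in
    \<open>parts_gf 1\<close>.\<close>
  let ?w = "\<lambda>(p, E). (case p of (P, Q) \<Rightarrow> \<Sum>P + 1 * \<Sum>Q) + 2 * \<Sum>E"
  let ?f = "\<lambda>((P, Q), E). (P \<union> Q, (\<lambda>x. 2 * x) ` E)"
  have inj2: "inj_on (\<lambda>x::nat. 2 * x) E" for E by (simp add: inj_on_def)
  have disj: "P \<inter> Q = {}" if "P \<subseteq> {1..l}" "\<forall>x\<in>Q. l < x" for P Q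
    using that by (meson atLeastAtMost_iff disjoint_iff leD subsetD)
  have grP: "graded (Pow {1..l}) (\<lambda>B. \<Sum>B)" by (simp add: graded_def)
  have gr1: "graded (parts_above k l) (\<lambda>B. 1 * \<Sum>B)"
    and gr2: "graded (parts_above l 0) (\<lambda>B. 2 * \<Sum>B)"
    by (rule graded_parts_above; simp)+
  \<comment> \<open>The bijection preserves weights, so this is the case \<open>c = 0\<close> of
    \<open>gen_fun_bij\<close>.\<close>
  have "gen_fun (A_pairs k l) weight = fps_X ^ 0 * gen_fun ?S ?w"
  proof (rule gen_fun_bij)
    show "bij_betw ?f ?S (A_pairs k l)"
    proof (rule bij_betwI[where g = "\<lambda>(R, G). ((R \<inter> {1..l}, {a \<in> R. l < a}), (\<lambda>x. 2 * x) -` G)"])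
      show "?f \<in> ?S \<rightarrow> A_pairs k l"
      proof
        fix q assume q: "q \<in> ?S"
        obtain P Q E where [simp]: "q = ((P, Q), E)" by (metis surj_pair)
        have P: "P \<subseteq> {1..l}" and Q: "finite Q" "card Q = k" "\<And>x. x \<in> Q \<Longrightarrow> l < x"
          and E: "finite E" "card E = l" "0 \<notin> E"
          using q by (auto simp: parts_above_def)
        have "{a \<in> P \<union> Q. l < a} = Q" using P Q(3) by fastforce
        moreover have "finite P" using P by (rule finite_subset) simp
        moreover have "0 \<notin> P \<union> Q" using P Q(3) by fastforce
        ultimately show "?f q \<in> A_pairs k l"
          using Q E by (auto simp: A_pairs_def card_image[OF inj2])
      qed
      show "(\<lambda>(R, G). ((R \<inter> {1..l}, {a \<in> R. l < a}), (\<lambda>x. 2 * x) -` G)) \<in> A_pairs k l \<rightarrow> ?S"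
      proof
        fix p assume p: "p \<in> A_pairs k l"
        obtain R G where [simp]: "p = (R, G)" by force
        have "(\<lambda>x. 2 * x) ` ((\<lambda>x. 2 * x) -` G) = G"
          using p by (auto simp: A_pairs_def elim!: evenE)
        then have "card ((\<lambda>x. 2 * x) -` G) = card G" by (metis card_image inj2)
        moreover have "finite ((\<lambda>x. 2 * x) -` G)"
          using p by (auto simp: A_pairs_def intro!: finite_vimageI inj2)
        ultimately show "(\<lambda>(R, G). ((R \<inter> {1..l}, {a \<in> R. l < a}), (\<lambda>x. 2 * x) -` G)) p \<in> ?S"
          using p by (auto simp: A_pairs_def parts_above_def intro: gr0I)
      qed
      show "?f ((\<lambda>(R, G). ((R \<inter> {1..l}, {a \<in> R. l < a}), (\<lambda>x. 2 * x) -` G)) p) = p"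
        if p: "p \<in> A_pairs k l" for p
      proof -
        obtain R G where [simp]: "p = (R, G)" by force
        have "(\<lambda>x. 2 * x) ` ((\<lambda>x. 2 * x) -` G) = G"
          using p by (auto simp: A_pairs_def elim!: evenE)
        moreover have "R \<inter> {1..l} \<union> {a \<in> R. l < a} = R"
          using p by (auto simp: A_pairs_def) (metis not_less_eq_eq le_zero_eq)
        ultimately show ?thesis by simp
      qed
      show "(\<lambda>(R, G). ((R \<inter> {1..l}, {a \<in> R. l < a}), (\<lambda>x. 2 * x) -` G)) (?f q) = q"
        if "q \<in> ?S" for q
      proof -
        obtain P Q E where [simp]: "q = ((P, Q), E)" by (metis surj_pair)
        have P: "\<And>x. x \<in> P \<Longrightarrow> 1 \<le> x \<and> x \<le> l" and Q: "\<And>x. x \<in> Q \<Longrightarrow> \<not> x \<le> l"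
          using that by (auto simp: parts_above_def)
        have "(P \<union> Q) \<inter> {1..l} = P" using P Q by auto
        moreover have "{a \<in> P \<union> Q. l < a} = Q" using P Q by (auto simp: not_le[symmetric])
        ultimately show ?thesis by (simp add: inj_vimage_image_eq[OF inj2])
      qed
    qed
    show "weight (?f q) = ?w q + 0" if q: "q \<in> ?S" for q
    proof -
      obtain P Q E where [simp]: "q = ((P, Q), E)" by (metis surj_pair)
      have "finite P" "finite Q" "P \<inter> Q = {}"
        using q disj by (auto simp: parts_above_def intro: finite_subset)
      then show ?thesis
        by (simp add: sum.union_disjoint sum.reindex[OF inj2] sum_distrib_left)
    qed
  qed
  moreover note gen_fun_times[OF graded_times[OF grP gr1] gr2]
  moreover note gen_fun_times[OF grP gr1]
  ultimately show ?thesis by simp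
qed

text \<open>Only the factor for the red parts above \<open>l\<close> depends on \<open>k\<close>.
  For \<open>k = 0\<close> both sides vanish.\<close>

lemma A_gf_rec_red:
  "(1 - fps_X ^ k) * gen_fun (A_pairs k l) weight =
    (if k = 0 then 0 else fps_X ^ (k + l) * gen_fun (A_pairs (k - 1) l) weight)"
proof (cases k)
  case (Suc k')
  show ?thesis
    using parts_gf_rec[of 1 k' l] Suc unfolding A_gf_prod by (simp add: mult_ac)
qed simp

text \<open>All three factors change with \<open>l\<close>: the small red parts gain
  \<open>1 + x\<close>, the large red parts gain \<open>fps_X ^ k\<close> from the raised bound, and
  the green parts obey a recurrence with \<open>1 - x * x\<close>. For \<open>l = 0\<close> both
  sides vanish.\<close>

lemma A_gf_rec_green:
  "(1 - fps_X ^ l) * gen_fun (A_pairs k l) weight =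
    (if l = 0 then 0 else fps_X ^ (2 * l + k) * gen_fun (A_pairs k (l - 1)) weight)"
proof (cases l)
  case (Suc m)
  define x :: "int fps" where "x = fps_X ^ Suc m"
  have "fps_nth (1 + x) 0 = 1" by (simp add: x_def)
  then have nz: "1 + x \<noteq> 0" by (metis fps_zero_nth zero_neq_one)
  have E: "(1 - x * x) * parts_gf 2 (Suc m) 0 = x * x * parts_gf 2 m 0"
    using parts_gf_rec[of 2 m 0] by (simp only: x_def mult_2 power_add) simp
  have R: "parts_gf 1 k (Suc m) = fps_X ^ k * parts_gf 1 k m"
    using parts_gf_shift[where c = 1 and k = k and s = m] by simp
  have P: "gen_fun (Pow {1..Suc m}) (\<lambda>B. \<Sum>B) = (1 + x) * gen_fun (Pow {1..m}) (\<lambda>B. \<Sum>B)"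
    using subsets_gf_Suc by (simp add: x_def)
  \<comment> \<open>Multiplying by \<open>1 + x\<close> completes \<open>1 - x\<close> to the factor
    \<open>1 - x * x\<close> of the green recurrence; it is cancelled again against the new small
    red factor.\<close>
  have "(1 + x) * ((1 - x) * gen_fun (A_pairs k (Suc m)) weight)
    = gen_fun (Pow {1..Suc m}) (\<lambda>B. \<Sum>B) * parts_gf 1 k (Suc m)
      * ((1 - x * x) * parts_gf 2 (Suc m) 0)"
    unfolding A_gf_prod by (simp add: algebra_simps)
  also have "\<dots> = (1 + x) * (x * x * fps_X ^ k * gen_fun (A_pairs k m) weight)"
    unfolding E R P A_gf_prod by (simp add: mult_ac)
  finally have "(1 - x) * gen_fun (A_pairs k (Suc m)) weight
      = x * x * fps_X ^ k * gen_fun (A_pairs k m) weight"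
    using nz by simp
  then show ?thesis using Suc by (simp add: x_def power_add mult_2_right mult_ac)
qed simp

lemma A_gf_rec:
  "(1 - fps_X ^ (k + l)) * gen_fun (A_pairs k l) weight =
    (if k = 0 then 0 else fps_X ^ (k + l) * gen_fun (A_pairs (k - 1) l) weight)
    + (if l = 0 then 0 else fps_X ^ (2 * (k + l)) * gen_fun (A_pairs k (l - 1)) weight)"
proof -
  have "(1 - fps_X ^ (k + l)) * gen_fun (A_pairs k l) weight
      = (1 - fps_X ^ k) * gen_fun (A_pairs k l) weight
        + fps_X ^ k * ((1 - fps_X ^ l) * gen_fun (A_pairs k l) weight)"
    by (simp add: algebra_simps power_add)
  also have "\<dots> = (if k = 0 then 0 else fps_X ^ (k + l) * gen_fun (A_pairs (k - 1) l) weight)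
    + (if l = 0 then 0 else fps_X ^ (2 * (k + l)) * gen_fun (A_pairs k (l - 1)) weight)"
    unfolding A_gf_rec_red A_gf_rec_green by (simp add: power_add mult_2_right mult_ac)
  finally show ?thesis .
qed

section \<open>Equality of the generating functions\<close>

text \<open>Both sides satisfy the same recurrence, which lowers \<open>k + l\<close> and determines
  the series once \<open>1 - fps_X ^ (k + l)\<close> can be cancelled.\<close>

lemma L_gf_eq_A_gf: "gen_fun (L_pairs k l 0) weight = gen_fun (A_pairs k l) weight"
proof (induction "k + l" arbitrary: k l rule: less_induct)
  case less
  show ?case
  proof (cases "k + l = 0")
    case True
    have "L_pairs 0 0 0 = {({}, {})}" by (auto simp: L_pairs_def)
    moreover have "gen_fun (A_pairs 0 0) weight = 1"
      unfolding A_gf_prod parts_gf_0 by (simp add: gen_fun_single)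
    ultimately show ?thesis using True by (simp add: gen_fun_single)
  next
    case False
    \<comment> \<open>For \<open>k + l = 0\<close> this factor is 0, which is why that case is
      treated directly.\<close>
    have "fps_nth (1 - fps_X ^ (k + l) :: int fps) 0 = 1" using False by simp
    then have nz: "(1 - fps_X ^ (k + l) :: int fps) \<noteq> 0" by (metis fps_zero_nth zero_neq_one)
    have "k \<noteq> 0 \<Longrightarrow> gen_fun (L_pairs (k - 1) l 0) weight = gen_fun (A_pairs (k - 1) l) weight"
      and "l \<noteq> 0 \<Longrightarrow> gen_fun (L_pairs k (l - 1) 0) weight = gen_fun (A_pairs k (l - 1)) weight"
      by (auto intro!: less)
    then have "(1 - fps_X ^ (k + l)) * gen_fun (L_pairs k l 0) weight
        = (1 - fps_X ^ (k + l)) * gen_fun (A_pairs k l) weight"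
      unfolding L_gf_rec A_gf_rec by auto
    with nz show ?thesis by simp
  qed
qed

section \<open>From pairs of sets to two-color partitions\<close>

text \<open>Since \<open>mset_set\<close> is empty on infinite sets, this encoding is faithful on
  pairs of finite sets only.\<close>

definition colored :: "nat set \<times> nat set \<Rightarrow> colored_part multiset" where
  "colored = (\<lambda>(R, G). image_mset (\<lambda>a. (a, Red)) (mset_set R) + image_mset (\<lambda>a. (a, Green)) (mset_set G))"

lemma values_of_colored [simp]:
  "values_of Red (colored (R, G)) = mset_set R" "values_of Green (colored (R, G)) = mset_set G"
  by (simp_all add: values_of_def colored_def filter_mset_image_mset multiset.map_comp comp_def)

lemma sum_colored: "sum_mset (image_mset fst (colored p)) = weight p"
  by (cases p) (simp add: colored_def multiset.map_comp comp_def sum_unfold_sum_mset)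

lemma in_colored:
  "finite R \<Longrightarrow> finite G \<Longrightarrow>
    (a, c) \<in># colored (R, G) \<longleftrightarrow> (case c of Red \<Rightarrow> a \<in> R | Green \<Rightarrow> a \<in> G)"
  by (cases c) (auto simp: colored_def)

lemma colored_in_two_color_partitions:
  "finite R \<Longrightarrow> finite G \<Longrightarrow>
    colored (R, G) \<in> two_color_partitions n \<longleftrightarrow> 0 \<notin> R \<union> G \<and> weight (R, G) = n"
  unfolding two_color_partitions_def mem_Collect_eq sum_colored
  by (auto simp: colored_def ball_Un intro: gr0I)

lemma inj_on_colored: "inj_on colored {(R, G). finite R \<and> finite G}"
proof (rule inj_onI, clarify)
  fix R G R' G'
  assume fin: "finite R" "finite G" "finite R'" "finite G'"
    and eq: "colored (R, G) = colored (R', G')"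
  have "mset_set R = mset_set R'" "mset_set G = mset_set G'"
    by (metis eq values_of_colored)+
  then show "R = R' \<and> G = G'"
    using fin by (metis finite_set_mset_mset_set)
qed

lemma values_of_decompose:
  "M = image_mset (\<lambda>a. (a, Red)) (values_of Red M) + image_mset (\<lambda>a. (a, Green)) (values_of Green M)"
proof (induction M)
  case (add p M)
  then show ?case by (cases p; cases "snd p") (auto simp: values_of_def)
qed (simp add: values_of_def)

lemma mset_set_set_mset_if_pairwise_distinct: "pairwise_distinct N \<Longrightarrow> mset_set (set_mset N) = N"
  unfolding pairwise_distinct_def
  by (rule multiset_eqI) (metis count_eq_zero_iff count_mset_set(1,3) count_greater_eq_one_iff finite_set_mset le_antisym)

lemma pairwise_distinct_mset_set: "pairwise_distinct (mset_set B)"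
  by (simp add: pairwise_distinct_def count_mset_set')

lemma colored_cases:
  assumes "pairwise_distinct (values_of Red M)" "pairwise_distinct (values_of Green M)"
  obtains R G where "finite R" "finite G" "M = colored (R, G)"
proof
  show "M = colored (set_mset (values_of Red M), set_mset (values_of Green M))"
    using values_of_decompose[of M] assms
    by (simp add: colored_def mset_set_set_mset_if_pairwise_distinct)
qed auto

lemma A_set_eq: "A_set n k l = colored ` {p \<in> A_pairs k l. weight p = n}"
proof -
  have *: "colored (R, G) \<in> A_set n k l \<longleftrightarrow> (R, G) \<in> A_pairs k l \<and> weight (R, G) = n"
    if "finite R" "finite G" for R G
  proof -
    \<comment> \<open>This provides \<open>j\<close>, the number of red parts that are at most
      \<open>l\<close>.\<close>
    have "card {a \<in> R. l < a} \<le> card R" using that by (intro card_mono) auto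
    then have "\<exists>j. card R = k + j" if "card {a \<in> R. l < a} = k"
      using that le_Suc_ex by blast
    then show ?thesis using that
      by (auto simp: A_set_def A_pairs_def colored_in_two_color_partitions pairwise_distinct_mset_set
          filter_mset_mset_set)
  qed
  show ?thesis
  proof (intro equalityI subsetI)
    fix M assume M: "M \<in> A_set n k l"
    then obtain R G where "finite R" "finite G" "M = colored (R, G)"
      by (auto simp: A_set_def elim: colored_cases)
    with M * show "M \<in> colored ` {p \<in> A_pairs k l. weight p = n}" by blast
  next
    fix M assume "M \<in> colored ` {p \<in> A_pairs k l. weight p = n}"
    then obtain R G where "M = colored (R, G)" "(R, G) \<in> A_pairs k l" "weight (R, G) = n" by auto
    moreover from this have "finite R" "finite G" by (auto simp: A_pairs_def)
    ultimately show "M \<in> A_set n k l" using * by simp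
  qed
qed

section \<open>Gap conditions on decreasing lists\<close>

text \<open>The list condition of \<open>L_set\<close> at \<open>d = 1\<close>, with
  \<open>1 + 1\<close> kept in the shape of \<open>d + 1\<close>.\<close>

definition gap_list :: "colored_part list \<Rightarrow> bool" where
  "gap_list ps \<longleftrightarrow> sorted_wrt (\<lambda>p q. fst p > fst q) ps \<and>
     (\<forall>i. Suc i < length ps \<longrightarrow>
        (snd (ps ! i) = Red \<longrightarrow> fst (ps ! i) \<ge> fst (ps ! Suc i) + 1) \<and>
        (snd (ps ! i) = Green \<longrightarrow> fst (ps ! i) \<ge> fst (ps ! Suc i) + (1 + 1)))"

lemma gap_list_distinct:
  assumes "gap_list ps" shows "distinct (map fst ps)"
proof -
  have "sorted_wrt (>) (map fst ps)" using assms by (simp add: gap_list_def sorted_wrt_map)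
  then show ?thesis
    by (auto simp: sorted_wrt_iff_nth_less distinct_conv_nth) (metis less_irrefl linorder_neqE_nat nth_map)
qed

text \<open>An entry \<open>a\<close> would come after the green \<open>Suc a\<close>, so the entry
  right after \<open>Suc a\<close> would be at least \<open>a\<close>, whereas the green gap forces
  it at least 2 below \<open>Suc a\<close>.\<close>

lemma gap_list_green:
  assumes ps: "gap_list ps" and green: "(Suc a, Green) \<in> set ps"
  shows "(a, c) \<notin> set ps"
proof
  assume "(a, c) \<in> set ps"
  then obtain j where j: "j < length ps" "ps ! j = (a, c)" by (auto simp: in_set_conv_nth)
  obtain i where i: "i < length ps" "ps ! i = (Suc a, Green)"
    using green by (auto simp: in_set_conv_nth)
  have dec: "fst (ps ! u) > fst (ps ! v)" if "u < v" "v < length ps" for u v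
    using ps that by (auto simp: gap_list_def sorted_wrt_iff_nth_less)
  have "i < j"
    using dec[of j i] i j by (cases i j rule: linorder_cases) auto
  then have "Suc i < length ps" and "fst (ps ! j) \<le> fst (ps ! Suc i)"
    using j dec[of "Suc i" j] by (auto simp: le_less Suc_le_eq dest: Suc_lessI)
  moreover from this(1) have "fst (ps ! i) \<ge> fst (ps ! Suc i) + 2"
    using ps i by (auto simp: gap_list_def)
  ultimately show False using i j by simp
qed

text \<open>Turns the condition on neighbours in a list into one on the two sets. Conversely, the
  decreasing list of \<open>R \<union> G\<close> has the required gaps.\<close>

lemma gap_list_colored:
  assumes "finite R" "finite G"
  shows "(\<exists>ps. mset ps = colored (R, G) \<and> gap_list ps) \<longleftrightarrow>
    R \<inter> G = {} \<and> (\<forall>a. Suc a \<in> G \<longrightarrow> a \<notin> R \<union> G)" (is "?lhs \<longleftrightarrow> ?rhs")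
proof
  assume ?lhs
  then obtain ps where ps: "mset ps = colored (R, G)" "gap_list ps" by blast
  have mem: "(a, c) \<in> set ps \<longleftrightarrow> (case c of Red \<Rightarrow> a \<in> R | Green \<Rightarrow> a \<in> G)" for a c
    using in_colored[OF assms, of a c] by (simp flip: ps(1))
  have "inj_on fst (set ps)" using gap_list_distinct[OF ps(2)] by (simp add: distinct_map)
  then have "\<not> ((a, Red) \<in> set ps \<and> (a, Green) \<in> set ps)" for a
    by (metis color.distinct(1) fst_conv inj_onD snd_conv)
  then have "\<not> (a \<in> R \<and> a \<in> G)" for a
    by (simp add: mem)
  moreover have "a \<notin> R \<union> G" if "Suc a \<in> G" for a
    using gap_list_green[OF ps(2), of a Red] gap_list_green[OF ps(2), of a Green] that
    by (simp add: mem)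
  ultimately show ?rhs by blast
next
  assume rhs: ?rhs
  \<comment> \<open>Disjointness of \<open>R\<close> and \<open>G\<close> makes this the correct
    color on \<open>G\<close> as well.\<close>
  define col where "col a = (a, if a \<in> R then Red else Green)" for a
  define vs where "vs = rev (sorted_list_of_set (R \<union> G))"
  have set_vs: "set vs = R \<union> G" using assms by (simp add: vs_def)
  have dec: "vs ! j < vs ! i" if "i < j" "j < length vs" for i j
  proof -
    have "sorted_wrt (>) vs" by (simp add: vs_def sorted_wrt_rev)
    then show ?thesis using that by (auto simp: sorted_wrt_iff_nth_less)
  qed
  have "mset (map col vs) = image_mset col (mset_set R) + image_mset col (mset_set G)"
  proof -
    have "mset vs = mset_set (R \<union> G)"
      unfolding set_vs[symmetric] by (simp add: vs_def mset_set_set)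
    also have "\<dots> = mset_set R + mset_set G"
      using assms rhs by (simp add: mset_set_Union)
    finally have "mset vs = mset_set R + mset_set G" .
    then show ?thesis by simp
  qed
  also have "image_mset col (mset_set R) = image_mset (\<lambda>a. (a, Red)) (mset_set R)"
    using assms by (intro image_mset_cong) (simp add: col_def)
  also have "image_mset col (mset_set G) = image_mset (\<lambda>a. (a, Green)) (mset_set G)"
    using assms rhs by (intro image_mset_cong) (auto simp: col_def)
  finally have "mset (map col vs) = colored (R, G)" by (simp add: colored_def)
  moreover have "gap_list (map col vs)"
    unfolding gap_list_def
  proof (intro conjI allI impI)
    show "sorted_wrt (\<lambda>p q. fst q < fst p) (map col vs)"
      using dec by (auto simp: sorted_wrt_iff_nth_less col_def)
  next
    fix i assume "Suc i < length (map col vs)"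
    then show "fst (map col vs ! Suc i) + 1 \<le> fst (map col vs ! i)"
      using dec[of i "Suc i"] by (simp add: col_def)
  next
    fix i assume i: "Suc i < length (map col vs)" and "snd (map col vs ! i) = Green"
    then have "vs ! i \<notin> R" by (auto simp: col_def split: if_splits)
    moreover have "vs ! i \<in> R \<union> G" "vs ! Suc i \<in> R \<union> G"
      using i unfolding set_vs[symmetric] by auto
    \<comment> \<open>Strict decrease gives a gap of at least 1, and excluding a gap of exactly 1
      leaves at least 2.\<close>
    ultimately have "vs ! i \<noteq> Suc (vs ! Suc i)" using rhs by auto
    then show "fst (map col vs ! Suc i) + (1 + 1) \<le> fst (map col vs ! i)"
      using dec[of i "Suc i"] i by (simp add: col_def)
  qed
  ultimately show ?lhs by blast
qed

text \<open>At floor 0 the bound \<open>s < x\<close> is positivity of the parts, and the floor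
  condition at \<open>a = 0\<close> is the exclusion of the green 1.\<close>

lemma L_set_eq:
  "{M \<in> L_set 1 n. size (values_of Red M) = k \<and> size (values_of Green M) = l}
    = colored ` {p \<in> L_pairs k l 0. weight p = n}" (is "?S = _")
proof -
  have L: "M \<in> L_set 1 n \<longleftrightarrow> M \<in> two_color_partitions n \<and> (\<exists>ps. mset ps = M \<and> gap_list ps)
      \<and> (1, Green) \<notin># M \<and> (0, Green) \<notin># M" for M
    by (simp add: L_set_def gap_list_def)
  have *: "colored (R, G) \<in> ?S \<longleftrightarrow> (R, G) \<in> L_pairs k l 0 \<and> weight (R, G) = n"
    if "finite R" "finite G" for R G
  proof -
    have "colored (R, G) \<in> L_set 1 n \<longleftrightarrow> 0 \<notin> R \<union> G \<and> weight (R, G) = n \<and>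
        R \<inter> G = {} \<and> (\<forall>a. Suc a \<in> G \<longrightarrow> a \<notin> R \<union> G) \<and> 1 \<notin> G"
      unfolding L gap_list_colored[OF that] colored_in_two_color_partitions[OF that]
        in_colored[OF that] by auto
    moreover have "(R, G) \<in> L_pairs k l 0 \<longleftrightarrow> card R = k \<and> card G = l \<and> R \<inter> G = {} \<and>
        0 \<notin> R \<union> G \<and> (\<forall>a. Suc a \<in> G \<longrightarrow> a \<notin> R \<union> G) \<and> 1 \<notin> G"
      using that by (auto simp: L_pairs_def intro: gr0I)
    ultimately show ?thesis by auto
  qed
  show ?thesis
  proof (intro equalityI subsetI)
    fix M assume M: "M \<in> ?S"
    then obtain ps where ps: "mset ps = M" "gap_list ps" unfolding L by blast
    \<comment> \<open>Values are distinct along the whole list, hence within each color, so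
      \<open>M\<close> comes from a pair of sets.\<close>
    have pd: "pairwise_distinct (values_of c M)" for c
    proof -
      have "distinct (map fst (filter (\<lambda>p. snd p = c) ps))"
        using gap_list_distinct[OF ps(2)] by (rule distinct_map_filter)
      moreover have "values_of c M = mset (map fst (filter (\<lambda>p. snd p = c) ps))"
        by (simp add: values_of_def flip: ps(1))
      ultimately show ?thesis
        by (simp add: pairwise_distinct_def distinct_count_atmost_1)
    qed
    obtain R G where "finite R" "finite G" "M = colored (R, G)"
      by (rule colored_cases[OF pd pd])
    with M * show "M \<in> colored ` {p \<in> L_pairs k l 0. weight p = n}" by blast
  next
    fix M assume "M \<in> colored ` {p \<in> L_pairs k l 0. weight p = n}"
    then obtain R G where "M = colored (R, G)" "(R, G) \<in> L_pairs k l 0" "weight (R, G) = n" by auto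
    moreover from this have "finite R" "finite G" by (auto simp: L_pairs_def)
    ultimately show "M \<in> ?S" using * by blast
  qed
qed

theorem theorem1p4:
  fixes n k l :: nat
  shows "L_count 1 n k l = A_count n k l"
proof -
  have "L_count 1 n k l = card {p \<in> L_pairs k l 0. weight p = n}"
    unfolding L_count_def L_set_eq
    by (rule card_image, rule inj_on_subset[OF inj_on_colored]) (auto simp: L_pairs_def)
  \<comment> \<open>Comparison of the coefficients of degree \<open>n\<close>.\<close>
  also have "\<dots> = card {p \<in> A_pairs k l. weight p = n}"
    using arg_cong[OF L_gf_eq_A_gf[of k l], of "\<lambda>F. fps_nth F n"] by (simp add: gen_fun_def)
  also have "\<dots> = A_count n k l"
    unfolding A_count_def A_set_eq
    by (rule card_image[symmetric], rule inj_on_subset[OF inj_on_colored]) (auto simp: A_pairs_def)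
  finally show ?thesis .
qed

end
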